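(* For every positive integer $n$, $P(n)=F(4n-1)$.
   Context: $P(n)$ is the number of strongly unimodal compositions of $n$ in which successive parts differ by exactly $1$ in absolute value, i.e. the number of triples $(x,y,z)$ of positive integers with $x\le y$, $z\le y$ and $n=x+(x+1)+\cdots+(y-1)+y+(y-1)+\cdots+(z+1)+z=y^2-\frac{x(x-1)}{2}-\frac{z(z-1)}{2}$. For a nonnegative integer $N$, the Hurwitz class number $H(N)$ is: $0$ if $N\equiv1,2\pmod 4$; $-1/12$ if $N=0$; and for $N>0$, $N\equiv 0,3\pmod 4$, the number of classes of positive definite binary quadratic forms of discriminant $-N$, with classes containing a multiple of $x^2+y^2$ (resp. $x^2+xy+y^2$) weighted $1/2$ (resp. $1/3$). For positive $m\equiv3\pmod4$, $F(m)=H(m)$ if $m\equiv 7\pmod 8$ and $F(m)=3H(m)$ if $m\equiv3\pmod8$. *)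

theory Defs
  imports Complex_Main
begin

definition strongly_unimodal :: "nat list \<Rightarrow> bool" where
  "strongly_unimodal xs \<longleftrightarrow>
     (\<exists>k < length xs. sorted_wrt (<) (take (Suc k) xs) \<and> sorted_wrt (>) (drop k xs))"

definition unit_steps :: "nat list \<Rightarrow> bool" where
  "unit_steps xs \<longleftrightarrow>
     (\<forall>i. Suc i < length xs \<longrightarrow> \<bar>int (xs ! Suc i) - int (xs ! i)\<bar> = 1)"

definition P_count :: "nat \<Rightarrow> nat" where
  "P_count n = card {xs. (\<forall>a \<in> set xs. 0 < a) \<and> sum_list xs = n \<and>
                         strongly_unimodal xs \<and> unit_steps xs}"

text \<open>The triple \<open>(a, b, c)\<close> stands for the integral form \<open>a x\<^sup>2 + b x y + c y\<^sup>2\<close>;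
  forms are not required to be primitive.\<close>

type_synonym bqf = "int \<times> int \<times> int"

fun bqf_eval :: "bqf \<Rightarrow> 'a \<Rightarrow> 'a \<Rightarrow> 'a::comm_ring_1" where
  "bqf_eval (a, b, c) x y = of_int a * x\<^sup>2 + of_int b * x * y + of_int c * y\<^sup>2"

fun bqf_disc :: "bqf \<Rightarrow> int" where
  "bqf_disc (a, b, c) = b\<^sup>2 - 4 * a * c"

definition bqf_pos_def :: "bqf \<Rightarrow> bool" where
  "bqf_pos_def f \<longleftrightarrow> (\<forall>x y :: real. (x, y) \<noteq> (0, 0) \<longrightarrow> bqf_eval f x y > 0)"

definition bqf_forms :: "nat \<Rightarrow> bqf set" where
  "bqf_forms N = {f. bqf_pos_def f \<and> bqf_disc f = - int N}"

text \<open>Proper equivalence, that is, equivalence under \<open>SL\<^sub>2(\<int>)\<close>.\<close>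

definition bqf_equiv :: "bqf \<Rightarrow> bqf \<Rightarrow> bool" where
  "bqf_equiv f g \<longleftrightarrow> (\<exists>p q r s :: int. p * s - q * r = 1 \<and>
     (\<forall>x y :: int. bqf_eval g x y = bqf_eval f (p * x + q * y) (r * x + s * y)))"

definition bqf_classes :: "nat \<Rightarrow> bqf set set" where
  "bqf_classes N = bqf_forms N // {(f, g). f \<in> bqf_forms N \<and> g \<in> bqf_forms N \<and> bqf_equiv f g}"

text \<open>Multiples of \<open>x\<^sup>2 + y\<^sup>2\<close> and of \<open>x\<^sup>2 + x y + y\<^sup>2\<close>; no class contains both kinds.\<close>

definition class_weight :: "bqf set \<Rightarrow> rat" where
  "class_weight C =
     (if \<exists>m. (m, 0, m) \<in> C then 1 / 2
      else if \<exists>m. (m, m, m) \<in> C then 1 / 3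
      else 1)"

definition hurwitz_H :: "nat \<Rightarrow> rat" where
  "hurwitz_H N =
     (if N mod 4 = 1 \<or> N mod 4 = 2 then 0
      else if N = 0 then - 1 / 12
      else \<Sum>C \<in> bqf_classes N. class_weight C)"

definition F_hurwitz :: "nat \<Rightarrow> rat" where
  "F_hurwitz m =
     (if m mod 8 = 7 then hurwitz_H m
      else if m mod 8 = 3 then 3 * hurwitz_H m
      else undefined)"

end

theory Submission
  imports Defs
begin

text \<open>
  Put \<open>m = 4 n - 1\<close>. Writing \<open>w = 2 y\<close>, \<open>u = x + z - 1\<close>, \<open>v = x - z\<close>, the triples counted by
  \<open>P(n)\<close> become the solutions of \<open>w\<^sup>2 - u\<^sup>2 - v\<^sup>2 = m\<close> with \<open>w\<close> even in the cone
  \<open>\<bar>v\<bar> < u\<close>, \<open>u + \<bar>v\<bar> < w\<close>, which is a fundamental domain for the rotation group of this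
  ternary form, a \<open>(2, 4, \<infinity>)\<close> triangle group containing a copy of \<open>\<Gamma>\<^sub>0(2)\<close> with index 2.
  Hence \<open>P(n)\<close> is the number of forms \<open>(a, b, c)\<close> of discriminant \<open>- m\<close> with \<open>a\<close> odd in the
  fundamental domain \<open>- a < b \<le> a\<close>, \<open>\<bar>b\<bar> < 2 c\<close> of \<open>\<Gamma>\<^sub>0(2)\<close>; the two parities of \<open>v\<close>
  give the parts \<open>a < 2 c\<close> and \<open>a > 2 c\<close>. This domain consists of three copies of that of
  \<open>SL\<^sub>2(\<int>)\<close>, so a reduced form is hit once for each of the three points of the projective line
  over \<open>\<F>\<^sub>2\<close> at which it is odd: three times if \<open>m \<equiv> 3\<close> modulo 8, once if \<open>m \<equiv> 7\<close>.
  The weight \<open>1/3\<close> accounts for the three points being permuted by the automorphisms of a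
  multiple of \<open>x\<^sup>2 + x y + y\<^sup>2\<close>.
\<close>

subsection \<open>Reduction theory\<close>

text \<open>Gauss reduced forms of discriminant \<open>- m\<close>. Positive definiteness is built
  in: \<open>- a < b\<close> and \<open>b \<le> a\<close> force \<open>0 < a\<close>, and with
  \<open>a \<le> c\<close> the discriminant is negative. The asymmetric edges keep one form of each
  boundary pair.\<close>

definition reduced_forms :: "int \<Rightarrow> bqf set" where
  "reduced_forms m = {(a, b, c). 4 * a * c - b\<^sup>2 = m \<and> - a < b \<and> b \<le> a \<and> a \<le> c \<and> (a = c \<longrightarrow> 0 \<le> b)}"

fun bqf_subst :: "bqf \<Rightarrow> int \<Rightarrow> int \<Rightarrow> int \<Rightarrow> int \<Rightarrow> bqf" where
  "bqf_subst (a, b, c) p q r s =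
     (a * p\<^sup>2 + b * p * r + c * r\<^sup>2,
      2 * a * p * q + b * (p * s + q * r) + 2 * c * r * s,
      a * q\<^sup>2 + b * q * s + c * s\<^sup>2)"

lemma bqf_eval_subst:
  "bqf_eval (bqf_subst f p q r s) x y = bqf_eval f (p * x + q * y) (r * x + s * y)" for x y :: int
  by (cases f) (simp add: power2_eq_square algebra_simps)

text \<open>The values at \<open>(1, 0)\<close>, \<open>(0, 1)\<close> and \<open>(1, 1)\<close> are
  \<open>a\<close>, \<open>c\<close> and \<open>a + b + c\<close>.\<close>

lemma bqf_eqI:
  assumes "\<And>x y :: int. bqf_eval f x y = bqf_eval g x y"
  shows "f = g"
proof -
  obtain a b c a' b' c' where fg: "f = (a, b, c)" "g = (a', b', c')"
    by (metis prod_cases3)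
  show ?thesis
    using assms[of 1 0] assms[of 0 1] assms[of 1 1] by (simp add: fg)
qed

lemma bqf_equiv_iff_subst:
  "bqf_equiv f g \<longleftrightarrow> (\<exists>p q r s. p * s - q * r = 1 \<and> g = bqf_subst f p q r s)"
  unfolding bqf_equiv_def by (metis bqf_eqI bqf_eval_subst)

lemma bqf_equiv_refl: "bqf_equiv f f"
  unfolding bqf_equiv_def by (intro exI[of _ 1] exI[of _ 0]) auto

lemma bqf_equiv_sym:
  assumes "bqf_equiv f g"
  shows "bqf_equiv g f"
proof -
  obtain p q r s where det: "p * s - q * r = 1"
    and g: "\<And>x y :: int. bqf_eval g x y = bqf_eval f (p * x + q * y) (r * x + s * y)"
    using assms by (auto simp: bqf_equiv_def)
  \<comment> \<open>The witness is the inverse matrix, with rows \<open>(s, - q)\<close> and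
    \<open>(- r, p)\<close>.\<close>
  have "bqf_eval f x y = bqf_eval g (s * x + - q * y) (- r * x + p * y)" for x y
  proof -
    have "p * (s * x + - q * y) + q * (- r * x + p * y) = (p * s - q * r) * x"
      "r * (s * x + - q * y) + s * (- r * x + p * y) = (p * s - q * r) * y"
      by (simp_all add: algebra_simps)
    then show ?thesis by (simp add: g det)
  qed
  moreover have "s * p - - q * - r = 1" using det by (simp add: algebra_simps)
  ultimately show ?thesis unfolding bqf_equiv_def by blast
qed

lemma bqf_equiv_trans:
  assumes "bqf_equiv f g" "bqf_equiv g h"
  shows "bqf_equiv f h"
proof -
  obtain p q r s where det: "p * s - q * r = 1"
    and g: "\<And>x y :: int. bqf_eval g x y = bqf_eval f (p * x + q * y) (r * x + s * y)"
    using assms(1) by (auto simp: bqf_equiv_def)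
  obtain p' q' r' s' where det': "p' * s' - q' * r' = 1"
    and h: "\<And>x y :: int. bqf_eval h x y = bqf_eval g (p' * x + q' * y) (r' * x + s' * y)"
    using assms(2) by (auto simp: bqf_equiv_def)
  \<comment> \<open>Multiplicativity of the determinant for the product matrix.\<close>
  have "(p * p' + q * r') * (r * q' + s * s') - (p * q' + q * s') * (r * p' + s * r') =
      (p * s - q * r) * (p' * s' - q' * r')"
    by (simp add: algebra_simps)
  then have "(p * p' + q * r') * (r * q' + s * s') - (p * q' + q * s') * (r * p' + s * r') = 1"
    by (simp add: det det')
  moreover have "bqf_eval h x y = bqf_eval f ((p * p' + q * r') * x + (p * q' + q * s') * y)
      ((r * p' + s * r') * x + (r * q' + s * s') * y)" for x y
    by (simp add: g h algebra_simps)
  ultimately show ?thesis unfolding bqf_equiv_def by blast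
qed

text \<open>Completing the square writes \<open>4 * a\<close> times the form as
  \<open>(2 * a * x + b * y)^2 + N * y^2\<close>, so the sign of \<open>a\<close> decides.\<close>

lemma bqf_forms_iff:
  assumes "N > 0"
  shows "(a, b, c) \<in> bqf_forms N \<longleftrightarrow> 0 < a \<and> 4 * a * c - b\<^sup>2 = int N"
proof -
  have "bqf_pos_def (a, b, c) \<longleftrightarrow> 0 < a" if D: "4 * a * c - b\<^sup>2 = int N"
  proof
    assume "bqf_pos_def (a, b, c)"
    moreover have "(1 :: real, 0 :: real) \<noteq> (0, 0)" by simp
    ultimately have "bqf_eval (a, b, c) (1 :: real) 0 > 0"
      unfolding bqf_pos_def_def by blast
    then show "0 < a" by simp
  next
    assume a: "0 < a"
    have "real_of_int (4 * a * c - b\<^sup>2) = real N" by (simp only: D of_int_of_nat_eq)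
    then have D': "4 * real_of_int a * of_int c - (of_int b)\<^sup>2 = real N" by simp
    have "bqf_eval (a, b, c) x y > 0" if xy: "(x, y) \<noteq> (0, 0)" for x y :: real
    proof -
      have "4 * of_int a * bqf_eval (a, b, c) x y = (2 * of_int a * x + of_int b * y)\<^sup>2
          + (4 * of_int a * of_int c - (of_int b)\<^sup>2) * y\<^sup>2"
        by (simp add: power2_eq_square algebra_simps)
      also have "\<dots> = (2 * of_int a * x + of_int b * y)\<^sup>2 + real N * y\<^sup>2" by (simp add: D')
      also have "\<dots> > 0"
      proof (cases "y = 0")
        case True
        then show ?thesis using xy a by simp
      next
        case False
        then show ?thesis using assms by (intro add_nonneg_pos) simp_all
      qed
      finally show ?thesis using a by (simp add: zero_less_mult_iff)
    qed
    then show "bqf_pos_def (a, b, c)" by (simp add: bqf_pos_def_def)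
  qed
  moreover have "b\<^sup>2 - 4 * a * c = - int N \<longleftrightarrow> 4 * a * c - b\<^sup>2 = int N" by auto
  ultimately show ?thesis by (auto simp: bqf_forms_def)
qed

section \<open>Existence of a reduced representative\<close>

lemma reduced_subset_forms: "N > 0 \<Longrightarrow> reduced_forms (int N) \<subseteq> bqf_forms N"
  by (auto simp: reduced_forms_def bqf_forms_iff)

lemma bqf_equiv_translate: "bqf_equiv (a, b, c) (a, b + 2 * a * k, a * k\<^sup>2 + b * k + c)"
  unfolding bqf_equiv_iff_subst
  by (intro exI[of _ 1] exI[of _ k] exI[of _ 0]) (auto simp: algebra_simps)

lemma bqf_equiv_swap: "bqf_equiv (a, b, c) (c, - b, a)"
  unfolding bqf_equiv_iff_subst
  by (intro exI[of _ 0] exI[of _ "- 1"] exI[of _ 1]) auto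

text \<open>Descent on the leading coefficient: translate to normalise the middle coefficient, then
  swap as long as the last one is smaller than the first.\<close>

lemma ex_reduced_equiv:
  assumes "N > 0" "f \<in> bqf_forms N"
  shows "\<exists>g \<in> reduced_forms (int N). bqf_equiv f g"
  using assms(2)
proof (induction "nat (fst f)" arbitrary: f rule: less_induct)
  case less
  obtain a b c where f: "f = (a, b, c)" by (metis prod_cases3)
  have a: "0 < a" and D: "4 * a * c - b\<^sup>2 = int N"
    using less.prems assms(1) by (auto simp: f bqf_forms_iff)
  \<comment> \<open>This quotient makes \<open>b'\<close> equal to \<open>a\<close> minus a
    remainder modulo \<open>2 * a\<close>.\<close>
  define k where "k = (a - b) div (2 * a)"
  define b' where "b' = b + 2 * a * k"
  define c' where "c' = a * k\<^sup>2 + b * k + c"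
  have eq: "bqf_equiv f (a, b', c')" unfolding f b'_def c'_def by (rule bqf_equiv_translate)
  have "a - b = 2 * a * k + (a - b) mod (2 * a)" unfolding k_def by simp
  moreover have "0 \<le> (a - b) mod (2 * a)" "(a - b) mod (2 * a) < 2 * a"
    using a by simp_all
  ultimately have b': "- a < b'" "b' \<le> a" by (simp_all add: b'_def)
  have D': "4 * a * c' - b'\<^sup>2 = int N"
    using D by (simp add: b'_def c'_def power2_eq_square algebra_simps)
  have "0 < 4 * a * c'" using D' assms(1) zero_le_power2[of b'] by linarith
  then have c': "0 < c'" using a by (simp add: zero_less_mult_iff)
  consider "c' < a" | "a = c'" "b' < 0" | "a \<le> c'" "a = c' \<longrightarrow> 0 \<le> b'" by linarith
  then show ?case
  proof cases
    case 1
    have "(c', - b', a) \<in> bqf_forms N"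
      using D' c' assms(1) by (simp add: bqf_forms_iff algebra_simps)
    then obtain g where "g \<in> reduced_forms (int N)" "bqf_equiv (c', - b', a) g"
      using less.hyps[of "(c', - b', a)"] 1 c' by (auto simp: f)
    then show ?thesis using eq bqf_equiv_swap bqf_equiv_trans by blast
  next
    \<comment> \<open>On the edge \<open>a = c'\<close> the swap only changes the sign of
      \<open>b'\<close>.\<close>
    case 2
    then have "(c', - b', a) \<in> reduced_forms (int N)"
      using D' b' by (simp add: reduced_forms_def algebra_simps)
    then show ?thesis using eq bqf_equiv_swap bqf_equiv_trans by blast
  next
    case 3
    then have "(a, b', c') \<in> reduced_forms (int N)"
      using D' b' by (simp add: reduced_forms_def)
    then show ?thesis using eq by blast
  qed
qed

section \<open>Uniqueness of the reduced representative\<close>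

text \<open>From \<open>\<bar>b\<bar> \<le> a\<close>, the form is at least
  \<open>a * (x^2 - \<bar>x * y\<bar> + y^2) + (c - a) * y^2\<close>, and the first bracket is a
  positive integer. The surplus \<open>(c - a) * y^2\<close> later forces \<open>y = 0\<close> at
  minimal vectors when \<open>a < c\<close>.\<close>

lemma reduced_value_ge:
  fixes a b c x y :: int
  assumes "\<bar>b\<bar> \<le> a" "a \<le> c" "(x, y) \<noteq> (0, 0)"
  shows "a + (c - a) * y\<^sup>2 \<le> a * x\<^sup>2 + b * x * y + c * y\<^sup>2"
proof -
  have "\<bar>b * (x * y)\<bar> \<le> a * \<bar>x * y\<bar>"
    unfolding abs_mult[of b] using assms(1) by (intro mult_right_mono) simp_all
  then have 1: "- (a * \<bar>x * y\<bar>) \<le> b * x * y" by (simp add: mult.assoc)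
  have "1 \<le> x\<^sup>2 - \<bar>x * y\<bar> + y\<^sup>2"
  proof -
    have "2 * (x\<^sup>2 - \<bar>x * y\<bar> + y\<^sup>2) = (\<bar>x\<bar> - \<bar>y\<bar>)\<^sup>2 + (x\<^sup>2 + y\<^sup>2)"
      by (simp add: power2_diff abs_mult)
    moreover have "0 < x\<^sup>2 + y\<^sup>2" using assms(3) by (simp add: sum_power2_gt_zero_iff)
    ultimately have "0 < 2 * (x\<^sup>2 - \<bar>x * y\<bar> + y\<^sup>2)"
      by (metis add_nonneg_pos zero_le_power2)
    then show ?thesis by simp
  qed
  then have "a * 1 \<le> a * (x\<^sup>2 - \<bar>x * y\<bar> + y\<^sup>2)" using assms(1) by (intro mult_left_mono) auto
  with 1 show ?thesis by (simp add: algebra_simps)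
qed

text \<open>The leading coefficient of an equivalent form is a value at the nonzero vector
  \<open>(p, r)\<close>, and \<open>a\<close> is the minimum of such values.\<close>

lemma reduced_equiv_leading_le:
  assumes "(a, b, c) \<in> reduced_forms m" "bqf_equiv (a, b, c) (a', b', c')"
  shows "a \<le> a'"
proof -
  obtain p q r s where det: "p * s - q * r = 1" and "a' = a * p\<^sup>2 + b * p * r + c * r\<^sup>2"
    using assms(2) by (auto simp: bqf_equiv_iff_subst)
  moreover have "(p, r) \<noteq> (0, 0)" using det by auto
  moreover have r: "\<bar>b\<bar> \<le> a" "a \<le> c" using assms(1) by (auto simp: reduced_forms_def)
  moreover have "0 \<le> (c - a) * r\<^sup>2" using r by simp
  ultimately show ?thesis using reduced_value_ge[of b a c p r] by linarith
qed

text \<open>When \<open>a < c\<close>, the minimum is attained only on the first axis, so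
  \<open>r = 0\<close> and the substitution is a translation up to sign. It shifts \<open>b\<close>
  by a multiple of \<open>2 * a\<close>, the length of the half-open interval containing both middle
  coefficients.\<close>

lemma reduced_equiv_middle_eq:
  assumes "(a, b, c) \<in> reduced_forms m" "(a, b', c') \<in> reduced_forms m"
    and eq: "bqf_equiv (a, b, c) (a, b', c')" and "a < c"
  shows "b = b'"
proof -
  obtain p q r s where det: "p * s - q * r = 1" and a: "a = a * p\<^sup>2 + b * p * r + c * r\<^sup>2"
    and b': "b' = 2 * a * p * q + b * (p * s + q * r) + 2 * c * r * s"
    using eq by (auto simp: bqf_equiv_iff_subst)
  have "(p, r) \<noteq> (0, 0)" using det by auto
  moreover have red: "- a < b" "b \<le> a" "- a < b'" "b' \<le> a" using assms(1,2)
    by (auto simp: reduced_forms_def)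
  ultimately have "(c - a) * r\<^sup>2 \<le> 0" using reduced_value_ge[of b a c p r] a assms(4) by linarith
  then have "r = 0" using assms(4) by (simp add: mult_le_0_iff)
  then have "p * s = 1" using det by simp
  then have shift: "b' = b + 2 * a * (p * q)" using b' \<open>r = 0\<close> by simp
  have "p * q = 0"
  proof (rule ccontr)
    assume "p * q \<noteq> 0"
    then have "1 \<le> \<bar>p * q\<bar>" by linarith
    then have "2 * a * 1 \<le> 2 * a * \<bar>p * q\<bar>" using red by (intro mult_left_mono) auto
    also have "\<dots> = \<bar>2 * a * (p * q)\<bar>" using red by (simp add: abs_mult)
    finally show False using red shift by linarith
  qed
  then show ?thesis using shift by simp
qed

text \<open>Minimality in both directions gives \<open>a = a'\<close>. If \<open>a < c\<close> or
  \<open>a < c'\<close>, rigidity gives \<open>b = b'\<close>; otherwise the discriminant gives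
  equal squares, and both middle coefficients are nonnegative.\<close>

lemma reduced_forms_eqI:
  assumes "f \<in> reduced_forms m" "g \<in> reduced_forms m" "bqf_equiv f g"
  shows "f = g"
proof -
  obtain a b c a' b' c' where fg: "f = (a, b, c)" "g = (a', b', c')"
    by (metis prod_cases3)
  have f: "(a, b, c) \<in> reduced_forms m" and g: "(a', b', c') \<in> reduced_forms m"
    and eq: "bqf_equiv (a, b, c) (a', b', c')" and eq': "bqf_equiv (a', b', c') (a, b, c)"
    using assms bqf_equiv_sym unfolding fg by blast+
  have aa: "a = a'"
    using reduced_equiv_leading_le[OF f eq] reduced_equiv_leading_le[OF g eq'] by simp
  have D: "4 * a * c - b\<^sup>2 = 4 * a * c' - b'\<^sup>2" and a0: "0 < a"
    using f g by (auto simp: reduced_forms_def aa)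
  have "b = b'"
  proof -
    consider "a < c" | "a < c'" | "a = c" "a = c'"
      using f g aa by (force simp: reduced_forms_def)
    then show ?thesis
    proof cases
      case 1
      then show ?thesis using reduced_equiv_middle_eq f g eq aa by blast
    next
      case 2
      then show ?thesis using reduced_equiv_middle_eq f g eq' aa by blast
    next
      case 3
      then have "b\<^sup>2 = b'\<^sup>2" "0 \<le> b" "0 \<le> b'"
        using f g aa D by (auto simp: reduced_forms_def)
      then show ?thesis by simp
    qed
  qed
  with D a0 show ?thesis by (simp add: fg aa)
qed

section \<open>The class number as a weighted count of reduced forms\<close>

lemma finite_reduced_forms: "finite (reduced_forms m)"
proof (rule finite_subset)
  show "reduced_forms m \<subseteq> {0..m} \<times> {- m..m} \<times> {0..m}"
  proof
    fix f assume "f \<in> reduced_forms m"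
    then obtain a b c where f: "f = (a, b, c)" and D: "4 * a * c - b\<^sup>2 = m"
      and r: "- a < b" "b \<le> a" "a \<le> c"
      by (auto simp: reduced_forms_def)
    \<comment> \<open>Since \<open>b^2 \<le> a^2 \<le> a * c\<close>, the discriminant gives
      \<open>m \<ge> 3 * a * c \<ge> c\<close>.\<close>
    have "b\<^sup>2 \<le> a\<^sup>2" using r by (intro power2_le_iff_abs_le[THEN iffD2]) auto
    moreover have "a * a \<le> a * c" "1 * c \<le> a * c" using r by (auto intro!: mult_mono)
    ultimately have "c \<le> m" using D r unfolding power2_eq_square by linarith
    then show "f \<in> {0..m} \<times> {- m..m} \<times> {0..m}" using r by (auto simp: f)
  qed
qed auto

text \<open>Each class contains exactly one reduced form, so the sum over classes can be
  reindexed.\<close>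

lemma hurwitz_sum_reduced:
  assumes "N mod 4 = 3"
  shows "hurwitz_H N =
    (\<Sum>f \<in> reduced_forms (int N). if \<exists>k. f = (k, k, k) then 1 / 3 else 1)"
proof -
  have N: "N > 0" using assms by (cases N) auto
  let ?E = "{(f, g). f \<in> bqf_forms N \<and> g \<in> bqf_forms N \<and> bqf_equiv f g}"
  let ?R = "reduced_forms (int N)"
  have "equiv (bqf_forms N) ?E"
    by (intro equivI) (auto simp: refl_on_def sym_def trans_def
      intro: bqf_equiv_refl bqf_equiv_sym bqf_equiv_trans)
  have cls: "bqf_classes N = (\<lambda>f. ?E `` {f}) ` ?R"
  proof
    show "bqf_classes N \<subseteq> (\<lambda>f. ?E `` {f}) ` ?R"
    proof
      fix C assume "C \<in> bqf_classes N"
      then obtain f where f: "f \<in> bqf_forms N" "C = ?E `` {f}"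
        by (auto simp: bqf_classes_def quotient_def)
      then obtain g where g: "g \<in> ?R" "bqf_equiv f g" using ex_reduced_equiv[OF N] by blast
      then have "(f, g) \<in> ?E" using f reduced_subset_forms[OF N] by auto
      then have "C = ?E `` {g}" using f(2) equiv_class_eq[OF \<open>equiv _ _\<close>] by blast
      then show "C \<in> (\<lambda>f. ?E `` {f}) ` ?R" using g by blast
    qed
    show "(\<lambda>f. ?E `` {f}) ` ?R \<subseteq> bqf_classes N"
      using reduced_subset_forms[OF N] unfolding bqf_classes_def by (blast intro: quotientI)
  qed
  have inj: "inj_on (\<lambda>f. ?E `` {f}) ?R"
  proof (rule inj_onI)
    fix f g assume fg: "f \<in> ?R" "g \<in> ?R" and "?E `` {f} = ?E `` {g}"
    then have "(f, g) \<in> ?E"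
      using eq_equiv_class[OF _ \<open>equiv _ _\<close>] reduced_subset_forms[OF N] by blast
    then show "f = g" using fg reduced_forms_eqI by blast
  qed
  have wt: "class_weight (?E `` {f}) = (if \<exists>k. f = (k, k, k) then 1 / 3 else 1)" if f: "f \<in> ?R" for f
  proof -
    \<comment> \<open>Such a form has discriminant \<open>- 4 * k^2\<close>, so the weight
      \<open>1 / 2\<close> does not occur for \<open>N\<close> congruent to 3 modulo 4.\<close>
    have "(k, 0, k) \<notin> bqf_forms N" for k
    proof
      assume "(k, 0, k) \<in> bqf_forms N"
      then have "4 * (k * k) = int N" by (simp add: bqf_forms_iff N)
      then have "int N mod 4 = 0" by (metis mod_mult_self1_is_0)
      then have "int (N mod 4) = 0" by (simp add: of_nat_mod)
      then show False using assms by simp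
    qed
    then have 1: "(\<exists>k. (k, 0, k) \<in> ?E `` {f}) \<longleftrightarrow> False" by auto
    \<comment> \<open>\<open>(k, k, k)\<close> is itself reduced, so uniqueness identifies it with
      \<open>f\<close>.\<close>
    have "(k, k, k) \<in> ?E `` {f} \<longleftrightarrow> f = (k, k, k)" for k
    proof
      assume k: "(k, k, k) \<in> ?E `` {f}"
      then have "(k, k, k) \<in> ?R" using N by (auto simp: bqf_forms_iff reduced_forms_def)
      then show "f = (k, k, k)" using f k reduced_forms_eqI by blast
    next
      assume "f = (k, k, k)"
      then show "(k, k, k) \<in> ?E `` {f}" using f reduced_subset_forms[OF N] bqf_equiv_refl by auto
    qed
    then show ?thesis unfolding class_weight_def by (simp only: 1 if_False)
  qed
  have "hurwitz_H N = (\<Sum>C \<in> bqf_classes N. class_weight C)"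
    using assms N by (simp add: hurwitz_H_def)
  also have "\<dots> = (\<Sum>f \<in> ?R. class_weight (?E `` {f}))"
    unfolding cls using sum.reindex[OF inj] by simp
  also have "\<dots> = (\<Sum>f \<in> ?R. if \<exists>k. f = (k, k, k) then 1 / 3 else 1)"
    using wt by (intro sum.cong) auto
  finally show ?thesis .
qed

subsection \<open>Compositions as triples\<close>

text \<open>The equation for \<open>n\<close> is doubled and rearranged to avoid division and
  truncated subtraction; \<open>x - 1\<close> and \<open>z - 1\<close> are exact because
  \<open>x\<close> and \<open>z\<close> are positive.\<close>

definition peak_triples :: "nat \<Rightarrow> (nat \<times> nat \<times> nat) set" where
  "peak_triples n = {(x, y, z). 0 < x \<and> x \<le> y \<and> 0 < z \<and> z \<le> y \<and>
     x * (x - 1) + z * (z - 1) + 2 * n = 2 * y\<^sup>2}"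

fun peak_list :: "nat \<times> nat \<times> nat \<Rightarrow> nat list" where
  "peak_list (x, y, z) = [x..<y] @ rev [z..<Suc y]"

lemma unit_steps_Cons:
  "unit_steps (a # b # xs) \<longleftrightarrow> \<bar>int b - int a\<bar> = 1 \<and> unit_steps (b # xs)"
proof
  assume H: "unit_steps (a # b # xs)"
  have "\<bar>int ((a # b # xs) ! Suc i) - int ((a # b # xs) ! i)\<bar> = 1"
    if "Suc i < length (a # b # xs)" for i
    using H that unfolding unit_steps_def by blast
  from this[of 0] this[of "Suc i" for i]
  show "\<bar>int b - int a\<bar> = 1 \<and> unit_steps (b # xs)" unfolding unit_steps_def by simp
next
  assume "\<bar>int b - int a\<bar> = 1 \<and> unit_steps (b # xs)"
  then show "unit_steps (a # b # xs)"
    unfolding unit_steps_def by (auto simp: nth_Cons split: nat.splits)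
qed

lemma unit_steps_rev:
  assumes "unit_steps xs"
  shows "unit_steps (rev xs)"
  unfolding unit_steps_def
proof (intro allI impI)
  fix i assume i: "Suc i < length (rev xs)"
  define j where "j = length xs - Suc (Suc i)"
  have "rev xs ! Suc i = xs ! j" "rev xs ! i = xs ! Suc j" "Suc j < length xs"
    using i by (auto simp: j_def rev_nth Suc_diff_Suc)
  then show "\<bar>int (rev xs ! Suc i) - int (rev xs ! i)\<bar> = 1"
    using assms unfolding unit_steps_def by (metis abs_minus_commute)
qed

lemma unit_steps_take: "unit_steps xs \<Longrightarrow> unit_steps (take k xs)"
  by (auto simp: unit_steps_def)

lemma unit_steps_drop: "unit_steps xs \<Longrightarrow> unit_steps (drop k xs)"
  by (auto simp: unit_steps_def)

text \<open>In an increasing list a step of absolute value 1 is a successor step.\<close>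

lemma unit_steps_increasing_eq_upt:
  "xs \<noteq> [] \<Longrightarrow> unit_steps xs \<Longrightarrow> sorted_wrt (<) xs \<Longrightarrow> xs = [hd xs..<Suc (last xs)] \<and> hd xs \<le> last xs"
proof (induction xs rule: induct_list012)
  case (3 a b xs)
  then have "b # xs = [b..<Suc (last (b # xs))]" "b \<le> last (b # xs)" "b = Suc a"
    by (auto simp: unit_steps_Cons)
  moreover from this have "[a..<Suc (last (b # xs))] = a # [b..<Suc (last (b # xs))]"
    by (simp add: upt_conv_Cons del: upt_Suc)
  ultimately show ?case by auto
qed auto

text \<open>The peak at index \<open>k\<close> belongs to both \<open>take (Suc k) xs\<close> and
  \<open>drop k xs\<close>; the first and the reverse of the second are increasing runs ending at
  \<open>y\<close>.\<close>

lemma peak_list_exhaust: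
  assumes "strongly_unimodal xs" "unit_steps xs"
  obtains x y z where "x \<le> y" "z \<le> y" "xs = peak_list (x, y, z)"
proof -
  obtain k where k: "k < length xs" "sorted_wrt (<) (take (Suc k) xs)" "sorted_wrt (>) (drop k xs)"
    using assms(1) by (auto simp: strongly_unimodal_def)
  define x y z where "x = hd xs" and "y = xs ! k" and "z = last xs"
  have "xs \<noteq> []" using k(1) by auto
  then have "take (Suc k) xs \<noteq> []" "hd (take (Suc k) xs) = x" "last (take (Suc k) xs) = y"
    using k(1) by (simp_all add: x_def y_def hd_take last_conv_nth)
  then have 1: "take (Suc k) xs = [x..<Suc y]" "x \<le> y"
    using unit_steps_increasing_eq_upt[of "take (Suc k) xs"] unit_steps_take assms(2) k(2) by auto
  have "rev (drop k xs) \<noteq> []" "hd (rev (drop k xs)) = z" "last (rev (drop k xs)) = y"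
    using k(1) by (auto simp: z_def y_def hd_rev last_rev hd_drop_conv_nth)
  moreover have "sorted_wrt (<) (rev (drop k xs))" using k(3) by (simp add: sorted_wrt_rev)
  ultimately have 2: "rev (drop k xs) = [z..<Suc y]" "z \<le> y"
    using unit_steps_increasing_eq_upt[of "rev (drop k xs)"] unit_steps_rev unit_steps_drop assms(2)
    by auto
  have "take k xs @ [y] = [x..<y] @ [y]"
    using 1 k(1) by (simp add: take_Suc_conv_app_nth y_def)
  moreover have "drop k xs = rev [z..<Suc y]" using 2 by (metis rev_rev_ident)
  ultimately have "xs = peak_list (x, y, z)" by (metis append_same_eq append_take_drop_id peak_list.simps)
  then show thesis using that 1 2 by blast
qed

lemma strongly_unimodal_peak_list:
  assumes "x \<le> y" "z \<le> y"
  shows "strongly_unimodal (peak_list (x, y, z))"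
proof -
  \<comment> \<open>The peak has index \<open>y - x\<close> and is shared by both runs.\<close>
  have "take (Suc (y - x)) (peak_list (x, y, z)) = [x..<Suc y]"
    "drop (y - x) (peak_list (x, y, z)) = rev [z..<Suc y]"
    using assms by simp_all
  moreover have "sorted_wrt (>) (rev [z..<Suc y])"
    by (simp add: sorted_wrt_rev del: upt_Suc)
  moreover have "sorted_wrt (<) [x..<Suc y]" by (simp del: upt_Suc)
  moreover have "y - x < length (peak_list (x, y, z))" using assms by simp
  ultimately show ?thesis unfolding strongly_unimodal_def by metis
qed

lemma unit_steps_peak_list:
  assumes "x \<le> y" "z \<le> y"
  shows "unit_steps (peak_list (x, y, z))"
  unfolding unit_steps_def
proof (intro allI impI)
  fix i assume "Suc i < length (peak_list (x, y, z))"
  \<comment> \<open>Within the list \<open>j - (y - x)\<close> is at most \<open>y - z\<close>, so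
    the subtraction from \<open>y\<close> is exact.\<close>
  moreover have "peak_list (x, y, z) ! j = (if j < y - x then x + j else y - (j - (y - x)))"
    if "j < length (peak_list (x, y, z))" for j
    using that assms by (auto simp: nth_append rev_nth simp del: upt_Suc)
  ultimately show "\<bar>int (peak_list (x, y, z) ! Suc i) - int (peak_list (x, y, z) ! i)\<bar> = 1"
    using assms by (auto simp del: peak_list.simps) (auto simp: of_nat_diff)
qed

lemma sum_list_upt: "x \<le> y \<Longrightarrow> 2 * sum_list [x..<y] + x * (x - 1) = y * (y - 1)"
proof (induction rule: dec_induct)
  case (step k)
  have "k * (k - 1) + 2 * k = Suc k * (Suc k - 1)" by (cases k) auto
  then show ?case using step by simp
qed auto

text \<open>After doubling, each run below the peak contributes \<open>y * (y - 1)\<close> less its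
  missing initial part, and the peak contributes \<open>2 * y\<close>.\<close>

lemma sum_list_peak_list:
  assumes "x \<le> y" "z \<le> y"
  shows "2 * sum_list (peak_list (x, y, z)) + x * (x - 1) + z * (z - 1) = 2 * y\<^sup>2"
proof -
  have "y * (y - 1) + y = y\<^sup>2" by (cases y) (auto simp: power2_eq_square)
  then show ?thesis
    using sum_list_upt[OF assms(1)] sum_list_upt[OF assms(2)] assms by (simp add: sum_list_rev)
qed

text \<open>The triple is recovered as first entry, maximum and last entry.\<close>

lemma inj_on_peak_list: "inj_on peak_list {(x, y, z). x \<le> y \<and> z \<le> y}"
proof (rule inj_onI)
  fix s t assume st: "s \<in> {(x, y, z). x \<le> y \<and> z \<le> y}" "t \<in> {(x, y, z). x \<le> y \<and> z \<le> y}"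
    and eq_st: "peak_list s = peak_list t"
  then obtain x y z x' y' z' where s: "s = (x, y, z)" and t: "t = (x', y', z')"
    and le: "x \<le> y" "z \<le> y" "x' \<le> y'" "z' \<le> y'" by auto
  have eq: "peak_list (x, y, z) = peak_list (x', y', z')" using eq_st unfolding s t .
  have hd: "hd (peak_list (x, y, z)) = x" if "x \<le> y" "z \<le> y" for x y z
    using that by (auto simp: hd_append)
  have last: "last (peak_list (x, y, z)) = z" if "x \<le> y" "z \<le> y" for x y z
    using that by (auto simp: last_append last_rev)
  have max: "Max (set (peak_list (x, y, z))) = y" if "x \<le> y" "z \<le> y" for x y z
    using that by (intro Max_eqI) auto
  show "s = t" unfolding s t
    using hd[OF le(1,2)] hd[OF le(3,4)] last[OF le(1,2)] last[OF le(3,4)]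
      max[OF le(1,2)] max[OF le(3,4)] eq by metis
qed

lemma P_count_eq_card_triples: "P_count n = card (peak_triples n)"
proof -
  have "inj_on peak_list (peak_triples n)"
    by (rule inj_on_subset[OF inj_on_peak_list]) (auto simp: peak_triples_def)
  moreover have "{xs. (\<forall>a \<in> set xs. 0 < a) \<and> sum_list xs = n \<and> strongly_unimodal xs \<and> unit_steps xs} =
      peak_list ` peak_triples n" (is "?L = ?R")
  proof
    show "?L \<subseteq> ?R"
    proof
      fix xs assume "xs \<in> ?L"
      then have xs: "\<forall>a \<in> set xs. 0 < a" "sum_list xs = n" "strongly_unimodal xs" "unit_steps xs"
        by auto
      then obtain x y z where L: "x \<le> y" "z \<le> y" "xs = peak_list (x, y, z)"
        using peak_list_exhaust by metis
      then have "x \<in> set xs" "z \<in> set xs" by auto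
      then have "(x, y, z) \<in> peak_triples n"
        using xs L sum_list_peak_list[OF L(1,2)] by (auto simp: peak_triples_def simp del: peak_list.simps)
      then show "xs \<in> ?R" using L by blast
    qed
    show "?R \<subseteq> ?L"
    proof clarify
      fix x y z assume "(x, y, z) \<in> peak_triples n"
      then have H: "0 < x" "x \<le> y" "0 < z" "z \<le> y"
        "x * (x - 1) + z * (z - 1) + 2 * n = 2 * y\<^sup>2" by (auto simp: peak_triples_def)
      then show "(\<forall>a \<in> set (peak_list (x, y, z)). 0 < a) \<and> sum_list (peak_list (x, y, z)) = n \<and>
          strongly_unimodal (peak_list (x, y, z)) \<and> unit_steps (peak_list (x, y, z))"
        using sum_list_peak_list[of x y z] strongly_unimodal_peak_list[of x y z]
          unit_steps_peak_list[of x y z] by auto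
    qed
  qed
  ultimately show ?thesis by (simp add: P_count_def card_image)
qed

subsection \<open>Forms of level 2\<close>

text \<open>The bound on \<open>\<bar>b\<bar>\<close> comes from the lower triangular matrices of
  \<open>\<Gamma>\<^sub>0(2)\<close>, which shift \<open>b\<close> by multiples of
  \<open>4 * c\<close>. For odd \<open>m\<close> also \<open>b\<close> is odd, so the edge
  \<open>\<bar>b\<bar> = 2 * c\<close> is empty.\<close>

definition level2_forms :: "int \<Rightarrow> bqf set" where
  "level2_forms m = {(a, b, c). 4 * a * c - b\<^sup>2 = m \<and> odd a \<and> - a < b \<and> b \<le> a \<and> \<bar>b\<bar> < 2 * c}"

lemma odd_middle_coeff:
  fixes a b c m :: int
  assumes "4 * a * c - b\<^sup>2 = m" "odd m"
  shows "odd b"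
proof
  assume "even b"
  then have "even (4 * a * c - b\<^sup>2)" by simp
  then show False using assms by simp
qed

section \<open>The bijection between triples and forms of level 2\<close>

text \<open>
  For even \<open>v\<close> the form \<open>(w - u, w - u + v, (w + v) / 2)\<close> is
  \<open>(w - u, 2 v, w + u)\<close> in the basis \<open>e\<^sub>1, (e\<^sub>1 + e\<^sub>2) / 2\<close> and has discriminant \<open>- m\<close>;
  \<open>triple_to_form\<close> is its translate with \<open>- a < b \<le> a\<close>. For odd \<open>v\<close> the roles of \<open>u\<close> and \<open>v\<close>
  are exchanged.
\<close>

definition triple_to_form :: "nat \<times> nat \<times> nat \<Rightarrow> bqf" where
  "triple_to_form = (\<lambda>(x, y, z). let w = 2 * int y; u = int x + int z - 1; v = int x - int z in
     if even v then (w - u, if v \<le> 0 then w - u - \<bar>v\<bar> else u + \<bar>v\<bar> - w, (w - \<bar>v\<bar>) div 2)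
     else (w - \<bar>v\<bar>, if v \<le> 0 then w - u - \<bar>v\<bar> else u + \<bar>v\<bar> - w, (w - u) div 2))"

text \<open>In the notation of \<open>triple_to_form\<close>, \<open>a\<close> and
  \<open>2 * c\<close> are \<open>w - u\<close> and \<open>w - \<bar>v\<bar>\<close>, the smaller
  being \<open>w - u\<close>, and \<open>\<bar>b\<bar> = w - u - \<bar>v\<bar>\<close>. In both
  orders \<open>w = 2 * c + q\<close>; the sign of \<open>b\<close> is opposite to that of
  \<open>v\<close>.\<close>

definition form_to_triple :: "bqf \<Rightarrow> nat \<times> nat \<times> nat" where
  "form_to_triple = (\<lambda>(a, b, c). let p = 2 * c - \<bar>b\<bar>; q = a - \<bar>b\<bar>; u = (if a < 2 * c then p else q);
       v = (if a < 2 * c then q else p); v' = (if 0 < b then - v else v) in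
     (nat ((u + v' + 1) div 2), nat (c + q div 2), nat ((u - v' + 1) div 2)))"

text \<open>With \<open>u = x + z - 1\<close> and \<open>v = x - z\<close>, one has
  \<open>u^2 + v^2 = 2 * x * (x - 1) + 2 * z * (z - 1) + 1\<close>.\<close>

lemma peak_triples_norm:
  assumes "0 < x" "0 < z"
  shows "x * (x - 1) + z * (z - 1) + 2 * n = 2 * y\<^sup>2 \<longleftrightarrow>
    (2 * int y)\<^sup>2 - (int x + int z - 1)\<^sup>2 - (int x - int z)\<^sup>2 = 4 * int n - 1"
proof -
  have "x * (x - 1) + z * (z - 1) + 2 * n = 2 * y\<^sup>2 \<longleftrightarrow>
      int (x * (x - 1) + z * (z - 1) + 2 * n) = int (2 * y\<^sup>2)" by linarith
  also have "\<dots> \<longleftrightarrow> int x * (int x - 1) + int z * (int z - 1) + 2 * int n = 2 * (int y)\<^sup>2"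
    using assms by (simp add: of_nat_diff)
  also have "\<dots> \<longleftrightarrow>
      (2 * int y)\<^sup>2 - (int x + int z - 1)\<^sup>2 - (int x - int z)\<^sup>2 = 4 * int n - 1"
    by (auto simp: power2_eq_square algebra_simps)
  finally show ?thesis .
qed

lemma triple_to_form_mem:
  assumes "(x, y, z) \<in> peak_triples n"
  shows "triple_to_form (x, y, z) \<in> level2_forms (4 * int n - 1) \<and>
    form_to_triple (triple_to_form (x, y, z)) = (x, y, z)"
proof -
  define w u v where "w = 2 * int y" and "u = int x + int z - 1" and "v = int x - int z"
  have xz: "0 < x" "0 < z" "x \<le> y" "z \<le> y" using assms by (auto simp: peak_triples_def)
  have norm: "w\<^sup>2 - u\<^sup>2 - v\<^sup>2 = 4 * int n - 1"
    using assms peak_triples_norm[OF xz(1,2)] by (auto simp: peak_triples_def w_def u_def v_def)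
  have uv: "\<bar>v\<bar> < u" "u + \<bar>v\<bar> < w" "odd (u + v)" "even w"
    using xz by (auto simp: w_def u_def v_def)
  have inv: "int x = (u + v + 1) div 2" "int y = w div 2" "int z = (u - v + 1) div 2"
    by (simp_all add: w_def u_def v_def)
  \<comment> \<open>For \<open>v = 0\<close> this gives \<open>b = w - u\<close>, the edge
    \<open>b = a\<close> that the domain retains.\<close>
  define b where "b = (if v \<le> 0 then w - u - \<bar>v\<bar> else u + \<bar>v\<bar> - w)"
  have b: "\<bar>b\<bar> = w - u - \<bar>v\<bar>" "0 < b \<longleftrightarrow> v \<le> 0" "b\<^sup>2 = (w - u - \<bar>v\<bar>)\<^sup>2"
    using uv by (auto simp: b_def power2_eq_square algebra_simps)
  have vv: "\<bar>v\<bar>\<^sup>2 = v\<^sup>2" by simp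
  \<comment> \<open>The identity is symmetric in \<open>u\<close> and \<open>\<bar>v\<bar>\<close>,
    so it serves both parities; the even one of the two factors becomes
    \<open>2 * c\<close>.\<close>
  have key: "2 * (w - u) * (w - \<bar>v\<bar>) - b\<^sup>2 = 4 * int n - 1"
    unfolding b norm[symmetric] vv[symmetric] by (simp add: power2_eq_square algebra_simps)
  show ?thesis
  proof (cases "even v")
    case True
    then have "even (w - \<bar>v\<bar>)" using uv by simp
    then obtain c where c: "w - \<bar>v\<bar> = 2 * c" by (elim evenE)
    then have T: "triple_to_form (x, y, z) = (w - u, b, c)"
      using True by (simp add: triple_to_form_def Let_def w_def u_def v_def b_def)
    have "odd u" using True uv by auto
    moreover have "4 * (w - u) * c - b\<^sup>2 = 4 * int n - 1" using key c by (simp add: algebra_simps)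
    moreover have "- (w - u) < b" "b \<le> w - u" "\<bar>b\<bar> < 2 * c" using b uv c by linarith+
    moreover have "form_to_triple (w - u, b, c) = (x, y, z)"
    proof -
      have "2 * c - \<bar>b\<bar> = u" "w - u - \<bar>b\<bar> = \<bar>v\<bar>" "w - u < 2 * c" using b uv c by linarith+
      moreover have "(if 0 < b then - \<bar>v\<bar> else \<bar>v\<bar>) = v" using b by auto
      moreover have "c + \<bar>v\<bar> div 2 = w div 2" using c by linarith
      ultimately show ?thesis
        unfolding form_to_triple_def Let_def prod.case by (simp only: if_True if_False flip: inv) simp
    qed
    ultimately show ?thesis using uv unfolding T by (simp add: level2_forms_def)
  next
    case False
    then have "even (w - u)" using uv by simp
    then obtain c where c: "w - u = 2 * c" by (elim evenE)
    then have T: "triple_to_form (x, y, z) = (w - \<bar>v\<bar>, b, c)"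
      using False by (simp add: triple_to_form_def Let_def w_def u_def v_def b_def)
    have "4 * (w - \<bar>v\<bar>) * c - b\<^sup>2 = 4 * int n - 1" using key c by (simp add: algebra_simps)
    \<comment> \<open>This makes \<open>\<bar>b\<bar> < 2 * c = w - u\<close> strict.\<close>
    moreover have "v \<noteq> 0" using False by auto
    moreover have "- (w - \<bar>v\<bar>) < b" "b \<le> w - \<bar>v\<bar>" "\<bar>b\<bar> < 2 * c"
      using b uv c \<open>v \<noteq> 0\<close> by linarith+
    moreover have "form_to_triple (w - \<bar>v\<bar>, b, c) = (x, y, z)"
    proof -
      have "2 * c - \<bar>b\<bar> = \<bar>v\<bar>" "w - \<bar>v\<bar> - \<bar>b\<bar> = u" "\<not> w - \<bar>v\<bar> < 2 * c" using b uv c by linarith+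
      moreover have "(if 0 < b then - \<bar>v\<bar> else \<bar>v\<bar>) = v" using b by auto
      moreover have "c + u div 2 = w div 2" using c by linarith
      ultimately show ?thesis
        unfolding form_to_triple_def Let_def prod.case by (simp only: if_True if_False flip: inv) simp
    qed
    ultimately show ?thesis using uv False unfolding T by (simp add: level2_forms_def)
  qed
qed

lemma form_to_triple_mem:
  assumes "(a, b, c) \<in> level2_forms (4 * int n - 1)"
  shows "form_to_triple (a, b, c) \<in> peak_triples n \<and>
    triple_to_form (form_to_triple (a, b, c)) = (a, b, c)"
proof -
  have D: "4 * a * c - b\<^sup>2 = 4 * int n - 1" and a: "odd a" "- a < b" "b \<le> a" "\<bar>b\<bar> < 2 * c"
    using assms by (auto simp: level2_forms_def)
  have b: "odd b" by (rule odd_middle_coeff[OF D]) simp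
  define p q where "p = 2 * c - \<bar>b\<bar>" and "q = a - \<bar>b\<bar>"
  have pq: "odd p" "even q" "0 < p" "0 \<le> q" using a b by (auto simp: p_def q_def)
  define u v where "u = (if a < 2 * c then p else q)"
    and "v = (if 0 < b then - 1 else 1) * (if a < 2 * c then q else p)"
  define w where "w = 2 * c + q"
  \<comment> \<open>An odd \<open>a\<close> differs from \<open>2 * c\<close>, so
    \<open>p \<noteq> q\<close> and \<open>\<bar>v\<bar> < u\<close> is strict.\<close>
  have ne: "a \<noteq> 2 * c" "b \<noteq> 0" using a b by auto
  then have uv: "\<bar>v\<bar> < u" "u + \<bar>v\<bar> < w" "odd (u + v)" "even w"
    using pq b by (auto simp: u_def v_def w_def p_def q_def)
  have norm: "w\<^sup>2 - u\<^sup>2 - v\<^sup>2 = 4 * int n - 1"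
  proof -
    have "u\<^sup>2 + v\<^sup>2 = p\<^sup>2 + q\<^sup>2" by (auto simp: u_def v_def)
    moreover have "w\<^sup>2 - p\<^sup>2 - q\<^sup>2 = 4 * a * c - \<bar>b\<bar>\<^sup>2"
      by (simp add: w_def p_def q_def power2_eq_square algebra_simps del: abs_mult_self_eq)
    ultimately show ?thesis using D by simp
  qed
  define x y z where "x = nat ((u + v + 1) div 2)" and "y = nat (w div 2)" and "z = nat ((u - v + 1) div 2)"
  have "even (u + v + 1)" "even (u - v + 1)" using uv by simp_all
  then have halves: "2 * ((u + v + 1) div 2) = u + v + 1" "2 * (w div 2) = w" "2 * ((u - v + 1) div 2) = u - v + 1"
    using uv by (simp_all only: dvd_mult_div_cancel)
  then have "0 \<le> (u + v + 1) div 2" "0 \<le> w div 2" "0 \<le> (u - v + 1) div 2" using uv by linarith+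
  then have xyz: "2 * int x = u + v + 1" "2 * int y = w" "2 * int z = u - v + 1"
    unfolding x_def y_def z_def using halves by (simp_all only: int_nat_eq if_True)
  then have uv_eq: "int x + int z - 1 = u" "int x - int z = v" by linarith+
  have pos: "0 < x" "x \<le> y" "0 < z" "z \<le> y" using uv xyz by linarith+
  have "w div 2 = c + q div 2" by (simp add: w_def)
  then have T: "form_to_triple (a, b, c) = (x, y, z)"
    unfolding form_to_triple_def Let_def prod.case x_def y_def z_def u_def v_def p_def q_def by auto
  have "(x, y, z) \<in> peak_triples n"
    using pos peak_triples_norm[OF pos(1,3), of n y] norm uv_eq xyz by (simp add: peak_triples_def)
  moreover have "triple_to_form (x, y, z) = (a, b, c)"
  proof -
    \<comment> \<open>\<open>v = 0\<close> requires \<open>q = 0\<close>, that is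
      \<open>\<bar>b\<bar> = a\<close>; the excluded edge \<open>b = - a\<close> then leaves
      \<open>b > 0\<close>.\<close>
    have sgn: "v \<le> 0 \<longleftrightarrow> 0 < b"
      using pq b ne a by (auto simp: v_def q_def p_def)
    have wuv: "w - u - \<bar>v\<bar> = \<bar>b\<bar>" using pq by (auto simp: w_def u_def v_def p_def q_def)
    have "even v \<longleftrightarrow> a < 2 * c" using pq by (auto simp: v_def)
    moreover have "w - u = a" "w - \<bar>v\<bar> = 2 * c" if "a < 2 * c"
      using that pq by (auto simp: w_def u_def v_def p_def q_def)
    moreover have "w - u = 2 * c" "w - \<bar>v\<bar> = a" if "\<not> a < 2 * c"
      using that pq by (auto simp: w_def u_def v_def p_def q_def)
    moreover have "(if v \<le> 0 then w - u - \<bar>v\<bar> else u + \<bar>v\<bar> - w) = b"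
      using sgn wuv b by auto
    ultimately show ?thesis
      unfolding triple_to_form_def Let_def prod.case uv_eq xyz by simp
  qed
  ultimately show ?thesis unfolding T by blast
qed

lemma card_peak_triples: "card (peak_triples n) = card (level2_forms (4 * int n - 1))"
proof -
  have fwd: "triple_to_form t \<in> level2_forms (4 * int n - 1) \<and> form_to_triple (triple_to_form t) = t"
    if "t \<in> peak_triples n" for t
    using that triple_to_form_mem by (cases t) blast
  have bwd: "form_to_triple f \<in> peak_triples n \<and> triple_to_form (form_to_triple f) = f"
    if "f \<in> level2_forms (4 * int n - 1)" for f
    using that form_to_triple_mem by (cases f) blast
  have "bij_betw triple_to_form (peak_triples n) (level2_forms (4 * int n - 1))"
  proof (rule bij_betw_byWitness[where f' = form_to_triple])
    show "\<forall>t \<in> peak_triples n. form_to_triple (triple_to_form t) = t"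
      "\<forall>f \<in> level2_forms (4 * int n - 1). triple_to_form (form_to_triple f) = f"
      by (simp_all add: fwd bwd)
    show "triple_to_form ` peak_triples n \<subseteq> level2_forms (4 * int n - 1)"
      "form_to_triple ` level2_forms (4 * int n - 1) \<subseteq> peak_triples n"
      by (simp_all add: image_subset_iff fwd bwd)
  qed
  then show ?thesis by (rule bij_betw_same_card)
qed

section \<open>Cutting the level 2 domain into three pieces\<close>

text \<open>
  Up to the sign of the middle coefficient, which does not matter for counting, \<open>shift_swap\<close> is
  \<open>x \<mapsto> x \<plusminus> y\<close> followed by an exchange of the variables. The sign is chosen such that the
  boundary cases \<open>a = b\<close> and \<open>a = c\<close> land on edges of the level 2 domain that are not covered by
  \<open>(a, b, c) \<mapsto> (c, - b, a)\<close>.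
\<close>

definition shift_swap :: "bqf \<Rightarrow> bqf" where
  "shift_swap = (\<lambda>(a, b, c). (a + c - \<bar>b\<bar>,
     if b < 0 \<or> a = b \<or> a = c then 2 * a - \<bar>b\<bar> else \<bar>b\<bar> - 2 * a, a))"

text \<open>The edges \<open>a = b\<close> and \<open>a = c\<close> of the reduced domain correspond
  here to \<open>c = b\<close> and \<open>a = b\<close>.\<close>

definition shift_swap_inv :: "bqf \<Rightarrow> bqf" where
  "shift_swap_inv = (\<lambda>(a, b, c). (c,
     if b < 0 \<or> a = b \<or> c = b then 2 * c - \<bar>b\<bar> else \<bar>b\<bar> - 2 * c, a + c - \<bar>b\<bar>))"

text \<open>With \<open>t = \<bar>b\<bar>\<close>, the form \<open>(a, 2 * a - t, a + c - t)\<close>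
  is the translate of \<open>(a, - t, c)\<close> by 1. The variants account for sign and
  order.\<close>

lemma shift_swap_norm:
  fixes a b c :: int
  shows "4 * a * (a + c - \<bar>b\<bar>) - (2 * a - \<bar>b\<bar>)\<^sup>2 = 4 * a * c - b\<^sup>2"
    and "4 * a * (a + c - \<bar>b\<bar>) - (\<bar>b\<bar> - 2 * a)\<^sup>2 = 4 * a * c - b\<^sup>2"
    and "4 * (a + c - \<bar>b\<bar>) * a - (2 * a - \<bar>b\<bar>)\<^sup>2 = 4 * a * c - b\<^sup>2"
    and "4 * (a + c - \<bar>b\<bar>) * a - (\<bar>b\<bar> - 2 * a)\<^sup>2 = 4 * a * c - b\<^sup>2"
proof -
  have *: "4 * a * (a + c - t) - (2 * a - t)\<^sup>2 = 4 * a * c - t\<^sup>2" for t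
    by (simp add: power2_eq_square algebra_simps)
  show "4 * a * (a + c - \<bar>b\<bar>) - (2 * a - \<bar>b\<bar>)\<^sup>2 = 4 * a * c - b\<^sup>2"
    using *[of "\<bar>b\<bar>"] by simp
  then show "4 * a * (a + c - \<bar>b\<bar>) - (\<bar>b\<bar> - 2 * a)\<^sup>2 = 4 * a * c - b\<^sup>2"
    "4 * (a + c - \<bar>b\<bar>) * a - (2 * a - \<bar>b\<bar>)\<^sup>2 = 4 * a * c - b\<^sup>2"
    "4 * (a + c - \<bar>b\<bar>) * a - (\<bar>b\<bar> - 2 * a)\<^sup>2 = 4 * a * c - b\<^sup>2"
    by (simp_all add: power2_commute[of "\<bar>b\<bar>"] mult.commute mult.left_commute)
qed

text \<open>An involution, hence its own inverse. The forms \<open>(k, k, k)\<close> are left out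
  because their images \<open>(k, - k, k)\<close> lie on the omitted edge
  \<open>b = - a\<close>.\<close>

lemma bij_betw_swap:
  assumes "odd m"
  shows "bij_betw (\<lambda>(a, b, c). (c, - b, a))
    {(a, b, c) \<in> reduced_forms m. odd c \<and> \<not> (a = b \<and> b = c)}
    {(a, b, c) \<in> level2_forms m. c < a \<and> \<bar>b\<bar> \<le> c \<and> b \<noteq> c \<or> a = c \<and> b < 0}"
    (is "bij_betw ?g ?S ?T")
proof (rule bij_betw_byWitness[where f' = ?g])
  have fwd: "?g f \<in> ?T" if f_mem: "f \<in> ?S" for f
  proof -
    obtain a b c where f: "f = (a, b, c)" by (metis prod_cases3)
    have D: "4 * a * c - b\<^sup>2 = m" "4 * c * a - b\<^sup>2 = m"
      and r: "- a < b" "b \<le> a" "a \<le> c" "a = c \<longrightarrow> 0 \<le> b" "odd c" "\<not> (a = b \<and> b = c)"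
      using f_mem by (auto simp: f reduced_forms_def algebra_simps)
    have "odd b" using odd_middle_coeff D(1) assms by blast
    then have "b \<noteq> 0" by auto
    then show ?thesis using D r unfolding f by (auto simp: level2_forms_def)
  qed
  then show "?g ` ?S \<subseteq> ?T" by (intro image_subsetI)
  have bwd: "?g f \<in> ?S" if f_mem: "f \<in> ?T" for f
  proof -
    obtain a b c where f: "f = (a, b, c)" by (metis prod_cases3)
    have D: "4 * c * a - b\<^sup>2 = m"
      and r: "- a < b" "b \<le> a" "\<bar>b\<bar> < 2 * c" "odd a"
      and "c < a \<and> \<bar>b\<bar> \<le> c \<and> b \<noteq> c \<or> a = c \<and> b < 0"
      using f_mem by (auto simp: f level2_forms_def algebra_simps)
    from this(6) show ?thesis
    proof
      assume "c < a \<and> \<bar>b\<bar> \<le> c \<and> b \<noteq> c"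
      with D r show ?thesis unfolding f by (auto simp: reduced_forms_def)
    next
      assume "a = c \<and> b < 0"
      with D r show ?thesis unfolding f by (auto simp: reduced_forms_def)
    qed
  qed
  then show "?g ` ?T \<subseteq> ?S" by (intro image_subsetI)
qed auto

text \<open>As \<open>b\<close> is odd, the new leading coefficient
  \<open>a + c - \<bar>b\<bar>\<close> is odd exactly when \<open>a + c\<close> is even. It exceeds
  \<open>a\<close> unless \<open>\<bar>b\<bar> = c\<close>, which for a reduced form means
  \<open>a = b = c\<close>.\<close>

lemma bij_betw_shift_swap:
  assumes "odd m"
  shows "bij_betw shift_swap
    {(a, b, c) \<in> reduced_forms m. even (a + c) \<and> \<not> (a = b \<and> b = c)}
    {(a, b, c) \<in> level2_forms m. c < a \<and> (c < \<bar>b\<bar> \<or> b = c)}"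
proof (rule bij_betw_byWitness[where f' = shift_swap_inv])
  let ?S = "{(a, b, c) \<in> reduced_forms m. even (a + c) \<and> \<not> (a = b \<and> b = c)}"
  let ?T = "{(a, b, c) \<in> level2_forms m. c < a \<and> (c < \<bar>b\<bar> \<or> b = c)}"
  have fwd: "shift_swap f \<in> ?T \<and> shift_swap_inv (shift_swap f) = f" if f_mem: "f \<in> ?S" for f
  proof -
    obtain a b c where f: "f = (a, b, c)" by (metis prod_cases3)
    have abc: "(a, b, c) \<in> ?S" using f_mem unfolding f .
    have D: "4 * a * c - b\<^sup>2 = m"
      and r: "- a < b" "b \<le> a" "a \<le> c" "a = c \<longrightarrow> 0 \<le> b" "even (a + c)" "\<not> (a = b \<and> b = c)"
      using abc by (auto simp: reduced_forms_def)
    have b: "odd b" using odd_middle_coeff D assms by blast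
    then have A: "odd (a + c - \<bar>b\<bar>)" using r(5) by simp
    have N: "4 * (a + c - \<bar>b\<bar>) * a - (2 * a - \<bar>b\<bar>)\<^sup>2 = m" "4 * (a + c - \<bar>b\<bar>) * a - (\<bar>b\<bar> - 2 * a)\<^sup>2 = m"
      using shift_swap_norm(3,4)[of a c b] D by simp_all
    have "b \<noteq> 0" using b by auto
    then consider "b < 0" | "0 < b" "a = b \<or> a = c" | "0 < b" "b < a" "a < c" using r by linarith
    then show ?thesis
    proof cases
      case 1
      then show ?thesis unfolding f using r N A
        by (auto simp: shift_swap_def shift_swap_inv_def level2_forms_def)
    next
      case 2
      then show ?thesis unfolding f using r N A
        by (auto simp: shift_swap_def shift_swap_inv_def level2_forms_def)
    next
      case 3
      then show ?thesis unfolding f using r N A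
        by (auto simp: shift_swap_def shift_swap_inv_def level2_forms_def)
    qed
  qed
  show "\<forall>f \<in> ?S. shift_swap_inv (shift_swap f) = f" by (intro ballI fwd[THEN conjunct2])
  show "shift_swap ` ?S \<subseteq> ?T" by (intro image_subsetI fwd[THEN conjunct1])
  have bwd: "shift_swap_inv f \<in> ?S \<and> shift_swap (shift_swap_inv f) = f" if f_mem: "f \<in> ?T" for f
  proof -
    obtain a b c where f: "f = (a, b, c)" by (metis prod_cases3)
    have abc: "(a, b, c) \<in> ?T" using f_mem unfolding f .
    have D: "4 * a * c - b\<^sup>2 = m" "4 * c * a - b\<^sup>2 = m"
      and r: "- a < b" "b \<le> a" "\<bar>b\<bar> < 2 * c" "odd a" "c < a" "c < \<bar>b\<bar> \<or> b = c"
      using abc by (auto simp: level2_forms_def algebra_simps)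
    have b: "odd b" using odd_middle_coeff D assms by blast
    then have A: "even (c + (a + c - \<bar>b\<bar>))" using r(4) by simp
    have N: "4 * c * (a + c - \<bar>b\<bar>) - (2 * c - \<bar>b\<bar>)\<^sup>2 = m" "4 * c * (a + c - \<bar>b\<bar>) - (\<bar>b\<bar> - 2 * c)\<^sup>2 = m"
      using shift_swap_norm(1,2)[of c a b] D by (simp_all add: add.commute)
    have "b \<noteq> 0" using b by auto
    then have "b < 0 \<or> 0 < b \<and> (a = b \<or> c = b) \<or> c < b \<and> b < a" using r(2,6) by auto
    then consider "b < 0" | "0 < b" "a = b \<or> c = b" | "c < b" "b < a" by blast
    then show ?thesis
    proof cases
      case 1
      then show ?thesis unfolding f using r A N
        by (auto simp: shift_swap_def shift_swap_inv_def reduced_forms_def)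
    next
      case 2
      then show ?thesis unfolding f using r A N
        by (auto simp: shift_swap_def shift_swap_inv_def reduced_forms_def)
    next
      case 3
      then show ?thesis unfolding f using r A N
        by (auto simp: shift_swap_def shift_swap_inv_def reduced_forms_def)
    qed
  qed
  show "\<forall>f \<in> ?T. shift_swap (shift_swap_inv f) = f" by (intro ballI bwd[THEN conjunct2])
  show "shift_swap_inv ` ?T \<subseteq> ?S" by (intro image_subsetI bwd[THEN conjunct1])
qed

text \<open>The pieces are the reduced forms with odd \<open>a\<close> and the images of the two
  bijections. A form \<open>(k, k, k)\<close> is counted in all three terms on the right but occurs
  once, whence the correction.\<close>

lemma card_level2_forms:
  assumes "odd m"
  shows "card (level2_forms m) + 2 * card {(a, b, c) \<in> reduced_forms m. a = b \<and> b = c} =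
    card {(a, b, c) \<in> reduced_forms m. odd a} + card {(a, b, c) \<in> reduced_forms m. odd c} +
    card {(a, b, c) \<in> reduced_forms m. even (a + c)}"
proof -
  let ?R = "reduced_forms m"
  let ?Q = "{(a, b, c) \<in> ?R. a = b \<and> b = c}"
  let ?R2 = "{(a, b, c) \<in> ?R. odd c \<and> \<not> (a = b \<and> b = c)}"
  let ?R3 = "{(a, b, c) \<in> ?R. even (a + c) \<and> \<not> (a = b \<and> b = c)}"
  let ?T1 = "{(a, b, c) \<in> ?R. odd a}"
  let ?T2 = "{(a, b, c) \<in> level2_forms m. c < a \<and> \<bar>b\<bar> \<le> c \<and> b \<noteq> c \<or> a = c \<and> b < 0}"
  let ?T3 = "{(a, b, c) \<in> level2_forms m. c < a \<and> (c < \<bar>b\<bar> \<or> b = c)}"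
  have fin: "finite A" if "A \<subseteq> ?R" for A
    using that finite_reduced_forms by (rule finite_subset)
  have fin_R: "finite ?T1" "finite ?R2" "finite ?R3" "finite ?Q" by (auto intro: fin)
  note T2 = bij_betw_swap[OF assms]
  note T3 = bij_betw_shift_swap[OF assms]
  have fin_T: "finite ?T2" "finite ?T3"
    using bij_betw_finite[OF T2] bij_betw_finite[OF T3] fin_R by simp_all
  have T1: "f \<in> ?T1 \<longleftrightarrow> f \<in> {(a, b, c) \<in> level2_forms m. a < c \<or> a = c \<and> 0 < b}" for f
  proof -
    obtain a b c where f: "f = (a, b, c)" by (metis prod_cases3)
    show ?thesis using odd_middle_coeff[OF _ assms, of a c b]
      by (cases "b = 0") (auto simp: f level2_forms_def reduced_forms_def)
  qed
  have "f \<in> level2_forms m \<longleftrightarrow> f \<in> ?T1 \<union> ?T2 \<union> ?T3" for f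
  proof -
    obtain a b c where f: "f = (a, b, c)" by (metis prod_cases3)
    \<comment> \<open>Closes the gap \<open>a = c\<close>, \<open>b = 0\<close> between the first
      two pieces.\<close>
    have "b \<noteq> 0" if "(a, b, c) \<in> level2_forms m"
      using odd_middle_coeff[OF _ assms, of a c b] that by (auto simp: level2_forms_def)
    then show ?thesis unfolding Un_iff T1 f by auto
  qed
  then have L: "level2_forms m = ?T1 \<union> ?T2 \<union> ?T3" by (rule set_eqI)
  have disj: "?T1 \<inter> ?T2 = {}" "(?T1 \<union> ?T2) \<inter> ?T3 = {}"
    unfolding set_eq_iff Int_iff Un_iff T1 by auto
  have "card (level2_forms m) = card (?T1 \<union> ?T2 \<union> ?T3)" by (rule arg_cong[OF L])
  also have "\<dots> = card (?T1 \<union> ?T2) + card ?T3"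
    by (rule card_Un_disjoint[OF finite_UnI[OF fin_R(1) fin_T(1)] fin_T(2) disj(2)])
  also have "card (?T1 \<union> ?T2) = card ?T1 + card ?T2"
    by (rule card_Un_disjoint[OF fin_R(1) fin_T(1) disj(1)])
  finally have "card (level2_forms m) = card ?T1 + card ?R2 + card ?R3"
    unfolding bij_betw_same_card[OF T2] bij_betw_same_card[OF T3] .
  moreover have "card {(a, b, c) \<in> ?R. odd c} = card ?R2 + card ?Q"
  proof -
    \<comment> \<open>Its middle coefficient is odd, so \<open>?Q\<close> lies in the set being
      split.\<close>
    have "odd c" if "(c, c, c) \<in> ?R" for c
      using that odd_middle_coeff[OF _ assms, of c c c] by (auto simp: reduced_forms_def)
    then have "{(a, b, c) \<in> ?R. odd c} = ?R2 \<union> ?Q" by auto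
    moreover have "?R2 \<inter> ?Q = {}" by auto
    ultimately show ?thesis using fin_R by (simp add: card_Un_disjoint)
  qed
  moreover have "card {(a, b, c) \<in> ?R. even (a + c)} = card ?R3 + card ?Q"
  proof -
    have "{(a, b, c) \<in> ?R. even (a + c)} = ?R3 \<union> ?Q" by auto
    moreover have "?R3 \<inter> ?Q = {}" by auto
    ultimately show ?thesis using fin_R by (simp add: card_Un_disjoint)
  qed
  ultimately show ?thesis by simp
qed

section \<open>Residues modulo 8 and the final count\<close>

text \<open>An odd square is 1 modulo 8, so \<open>4 * a * c\<close> is congruent to
  \<open>m + 1\<close>.\<close>

lemma even_outer_coeffs_iff:
  fixes a b c m :: int
  assumes D: "4 * a * c - b\<^sup>2 = m" and m: "m mod 4 = 3"
  shows "even (a * c) \<longleftrightarrow> m mod 8 = 7"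
proof -
  have "odd m" using m by presburger
  with D have "odd b" by (rule odd_middle_coeff)
  then obtain k where k: "b = 2 * k + 1" by (elim oddE)
  have "4 * (a * c) = m + 1 + 4 * (k * (k + 1))"
    using D by (simp add: k power2_eq_square algebra_simps)
  moreover have "even (k * (k + 1))" by simp
  then obtain l where "k * (k + 1) = 2 * l" by (elim evenE)
  ultimately have "4 * (a * c) = m + 1 + 8 * l" by simp
  moreover have "even e \<longleftrightarrow> m mod 8 = 7" if "4 * e = m + 1 + 8 * l" for e
    using that m by presburger
  ultimately show ?thesis by blast
qed

lemma card_level2_forms_eq_hurwitz:
  assumes N: "N mod 4 = 3"
  shows "rat_of_nat (card (level2_forms (int N))) = F_hurwitz N"
proof -
  define R where "R = reduced_forms (int N)"
  define Q where "Q = {(a, b, c) \<in> R. a = b \<and> b = c}"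
  let ?R1 = "{(a, b, c) \<in> R. odd a}"
  let ?R2 = "{(a, b, c) \<in> R. odd c}"
  let ?R3 = "{(a, b, c) \<in> R. even (a + c)}"
  have fin: "finite R" by (simp add: R_def finite_reduced_forms)
  have "int (N mod 4) = 3" using N by simp
  then have N': "int N mod 4 = 3" by (simp add: of_nat_mod)
  then have "odd (int N)" by presburger
  then have count: "card (level2_forms (int N)) + 2 * card Q = card ?R1 + card ?R2 + card ?R3"
    unfolding R_def Q_def by (rule card_level2_forms)
  have parity: "even (a * c) \<longleftrightarrow> int N mod 8 = 7" if "(a, b, c) \<in> R" for a b c
    using that even_outer_coeffs_iff[OF _ N', of a c b] by (auto simp: R_def reduced_forms_def)
  have Q: "Q \<subseteq> R" "Q = {f \<in> R. \<exists>k. f = (k, k, k)}" by (auto simp: Q_def)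
  have "hurwitz_H N = (\<Sum>f \<in> R. if \<exists>k. f = (k, k, k) then 1 / 3 else 1)"
    unfolding R_def by (rule hurwitz_sum_reduced[OF N])
  \<comment> \<open>The deficit \<open>2 / 3\<close> per element of \<open>Q\<close>, multiplied by
    3, is the correction in \<open>count\<close>.\<close>
  also have "\<dots> = (\<Sum>f \<in> R. 1 - (if f \<in> Q then 2 / 3 else 0))"
    by (intro sum.cong) (auto simp: Q(2))
  also have "\<dots> = rat_of_nat (card R) - 2 / 3 * rat_of_nat (card Q)"
    using fin Q(1) by (simp add: sum_subtractf sum.If_cases Int_absorb1)
  finally have H: "hurwitz_H N = rat_of_nat (card R) - 2 / 3 * rat_of_nat (card Q)" .
  have "N mod 8 = 7 \<or> N mod 8 = 3" using N by presburger
  then show ?thesis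
  proof
    assume 7: "N mod 8 = 7"
    then have "int (N mod 8) = 7" by simp
    \<comment> \<open>The three parity conditions now partition \<open>R\<close>, and
      \<open>Q\<close> is empty since its forms have odd coefficients.\<close>
    then have ev: "even a \<or> even c" if "(a, b, c) \<in> R" for a b c
      using parity[OF that] by (simp add: of_nat_mod)
    have odd_Q: "odd k" if "(k, k, k) \<in> R" for k
      using that odd_middle_coeff[OF _ \<open>odd (int N)\<close>, of k k k] by (auto simp: R_def reduced_forms_def)
    have "f \<notin> Q" for f
    proof
      assume "f \<in> Q"
      then obtain k where "(k, k, k) \<in> R" by (auto simp: Q(2))
      with ev[of k k k] odd_Q[of k] show False by simp
    qed
    then have "card Q = 0" using card_eq_0_iff by blast
    have fin_R: "finite ?R1" "finite ?R2" "finite ?R3" by (auto intro: finite_subset[OF _ fin])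
    have disj: "?R1 \<inter> ?R2 = {}" "(?R1 \<union> ?R2) \<inter> ?R3 = {}" using ev by auto
    have "R = ?R1 \<union> ?R2 \<union> ?R3" by auto
    then have "card R = card (?R1 \<union> ?R2 \<union> ?R3)" by (rule arg_cong)
    also have "\<dots> = card (?R1 \<union> ?R2) + card ?R3"
      by (rule card_Un_disjoint[OF finite_UnI[OF fin_R(1,2)] fin_R(3) disj(2)])
    also have "card (?R1 \<union> ?R2) = card ?R1 + card ?R2"
      by (rule card_Un_disjoint[OF fin_R(1,2) disj(1)])
    finally have "card R = card ?R1 + card ?R2 + card ?R3" .
    then show ?thesis using count H 7 \<open>card Q = 0\<close> by (simp add: F_hurwitz_def)
  next
    assume 3: "N mod 8 = 3"
    then have "int (N mod 8) = 3" by simp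
    \<comment> \<open>All three parity conditions now hold on the whole of \<open>R\<close>.\<close>
    then have od: "odd a \<and> odd c" if "(a, b, c) \<in> R" for a b c
      using parity[OF that] by (simp add: of_nat_mod)
    then have "?R1 = R" "?R2 = R" "?R3 = R" by auto
    then have "card (level2_forms (int N)) + 2 * card Q = 3 * card R" using count by simp
    then have "rat_of_nat (card (level2_forms (int N)) + 2 * card Q) = rat_of_nat (3 * card R)"
      by simp
    then show ?thesis using H 3 by (simp add: F_hurwitz_def algebra_simps)
  qed
qed

theorem theorem4p1:
  fixes n :: nat
  assumes "n > 0"
  shows "rat_of_nat (P_count n) = F_hurwitz (4 * n - 1)"
proof -
  \<comment> \<open>This form makes the natural subtraction in \<open>4 * n - 1\<close>
    exact.\<close>
  obtain k where n: "n = Suc k" using assms by (cases n) auto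
  have "(4 * n - 1) mod 4 = 3" by (simp add: n)
  then have "rat_of_nat (card (level2_forms (int (4 * n - 1)))) = F_hurwitz (4 * n - 1)"
    by (rule card_level2_forms_eq_hurwitz)
  moreover have "int (4 * n - 1) = 4 * int n - 1" by (simp add: n)
  ultimately show ?thesis by (simp only: P_count_eq_card_triples card_peak_triples)
qed

end
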